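(* As formal power series in $y,z$ with coefficients in $\mathbb{Z}[x]$, $$\sum_{n\ge 0}\sum_{k\ge 0}C(\Phi^n_k,x)\,y^nz^k=\frac{y}{1-y^2z\left(1+yz\left(1+xy^2z\right)\right)}.$$
   Context: A subword of a word is a block of consecutive letters. A binary word (over $\{0,1\}$) of length $n\ge 1$ is Padovan if it starts and ends with $0$, contains no subword $00$, and contains no subword $111$. For $n\ge1$ and $\lfloor n/2\rfloor\le k\le\lfloor(2n-2)/3\rfloor$, the weighted Padovan graph $\Phi^n_k$ is the simple graph whose vertices are all Padovan words of length $n$ with exactly $k$ letters $1$; two vertices are adjacent if one can be obtained from the other by replacing exactly one subword $01$ with $10$. The cube polynomial of a finite graph $G$ is $C(G,x)=\sum_{m\ge0}c_m(G)x^m$, where $c_m(G)$ is the number of induced subgraphs of $G$ isomorphic to the $m$-dimensional hypercube $Q_m$ (so $c_0(G)=|V(G)|$, $c_1(G)=|E(G)|$). Convention: for pairs $(n,k)$ of nonnegative integers with $n=0$ or $k$ outside the range $\lfloor n/2\rfloor\le k\le\lfloor(2n-2)/3\rfloor$, $\Phi^n_k$ is the empty graph and $C(\Phi^n_k,x)=0$. *)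

theory Defs
  imports
    "HOL-Library.Sublist"
    "HOL-Library.Z2"
    "HOL-Computational_Algebra.Polynomial"
    "HOL-Computational_Algebra.Formal_Power_Series"
    "Graph_Theory.Graph_Theory"
begin

text \<open>
  Binary words are lists over the two-element type \<open>bit\<close>; \<open>sublist\<close> is the
  contiguous-block relation, which is what is meant by subword.
\<close>

definition padovan :: "bit list \<Rightarrow> bool" where
  "padovan w \<longleftrightarrow> w \<noteq> [] \<and> hd w = 0 \<and> last w = 0 \<and>
     \<not> sublist [0, 0] w \<and> \<not> sublist [1, 1, 1] w"

definition swap01 :: "bit list \<Rightarrow> bit list \<Rightarrow> bool" where
  "swap01 u v \<longleftrightarrow> (\<exists>p s. u = p @ [0, 1] @ s \<and> v = p @ [1, 0] @ s)"

text \<open>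
  Simple graphs are symmetric loop-free digraphs without parallel arcs (\<open>pair_graph\<close>): an
  undirected edge is a pair of opposite arcs.  The guard \<open>1 \<le> n\<close> makes the
  truncated subtraction agree with the integer one.  Outside the range the vertex set, hence the
  graph, is empty.
\<close>

definition padovan_verts :: "nat \<Rightarrow> nat \<Rightarrow> bit list set" where
  "padovan_verts n k =
     (if 1 \<le> n \<and> n div 2 \<le> k \<and> k \<le> (2 * n - 2) div 3
      then {w. padovan w \<and> length w = n \<and> count_list w 1 = k} else {})"

definition padovan_graph :: "nat \<Rightarrow> nat \<Rightarrow> bit list pair_pre_digraph" where
  "padovan_graph n k =
     \<lparr> pverts = padovan_verts n k,
       parcs = {(u, v). u \<in> padovan_verts n k \<and> v \<in> padovan_verts n k \<and>
                        (swap01 u v \<or> swap01 v u)} \<rparr>"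

definition hypercube :: "nat \<Rightarrow> bit list pair_pre_digraph" where
  "hypercube m =
     \<lparr> pverts = {u. length u = m},
       parcs = {(u, v). length u = m \<and> length v = m \<and> card {i. i < m \<and> u ! i \<noteq> v ! i} = 1} \<rparr>"

definition cube_count :: "('a, 'b) pre_digraph \<Rightarrow> nat \<Rightarrow> nat" where
  "cube_count G m =
     card {H. induced_subgraph H G \<and> digraph_iso H (with_proj (hypercube m))}"

text \<open>
  \<open>induced_subgraph H G\<close> forces \<open>H\<close> to share the incidence maps of \<open>G\<close>, so each vertex subset
  contributes at most one \<open>H\<close>, see \<open>induced_subgraph_eqI\<close> below.  The coefficient
  sequence has finite support when \<open>G\<close> is finite, see \<open>coeff_cube_poly\<close> below.
\<close>

definition cube_poly :: "('a, 'b) pre_digraph \<Rightarrow> int poly" where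
  "cube_poly G = Abs_poly (\<lambda>m. int (cube_count G m))"

text \<open>
  The operator \<open>/\<close> on power series needs an \<open>inverse\<close> operation on the coefficients, which
  \<open>int poly\<close> and \<open>int poly fps\<close> do not have.  For a denominator with constant term 1 the quotient
  exists over every commutative ring, see \<open>fps_quot_unique\<close>.
\<close>

definition fps_quot :: "'a::comm_ring_1 fps \<Rightarrow> 'a fps \<Rightarrow> 'a fps" where
  "fps_quot N D = N * fps_right_inverse D 1"

lemma fps_quot_unique:
  fixes D :: "'a::comm_ring_1 fps"
  assumes "fps_nth D 0 = 1"
  shows "F = fps_quot N D \<longleftrightarrow> F * D = N"
proof -
  have inv: "D * fps_right_inverse D 1 = 1"
    using assms by (intro fps_right_inverse) simp
  show ?thesis
  proof
    assume "F = fps_quot N D"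
    then show "F * D = N"
      using inv by (simp add: fps_quot_def mult.assoc mult.commute[of "fps_right_inverse D 1" D])
  next
    assume "F * D = N"
    then have "fps_quot N D = F * (D * fps_right_inverse D 1)"
      unfolding fps_quot_def by (metis mult.assoc)
    then show "F = fps_quot N D" by (simp add: inv)
  qed
qed

lemma induced_subgraph_eqI:
  fixes G :: "('a, 'b) pre_digraph"
  assumes "induced_subgraph H G" "induced_subgraph H' G" "verts H = verts H'"
  shows "H = H'"
  using assms
  by (auto simp: induced_subgraph_def subgraph_def compatible_def intro!: pre_digraph.equality)

lemma finite_induced_subgraphs:
  fixes G :: "('a, 'b) pre_digraph"
  assumes "finite (verts G)"
  shows "finite {H. induced_subgraph H G}"
proof (rule finite_imageD)
  show "finite (verts ` {H. induced_subgraph H G})"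
    by (rule finite_subset[of _ "Pow (verts G)"])
       (auto simp: assms induced_subgraph_def subgraph_def)
  show "inj_on verts {H. induced_subgraph H G}"
    by (auto intro!: inj_onI induced_subgraph_eqI)
qed

lemma hypercube_verts: "pverts (hypercube m) = {u. length u = m}"
  by (simp add: hypercube_def)

lemma card_hypercube: "card (pverts (hypercube m)) = 2 ^ m"
proof -
  have U: "(UNIV :: bit set) = {0, 1}" by (auto intro: bit.exhaust)
  have "{u :: bit list. length u = m} = {u. set u \<subseteq> {0, 1} \<and> length u = m}"
    using U by auto
  then show ?thesis by (simp add: hypercube_verts card_lists_length_eq numeral_2_eq_2)
qed

lemma cube_count_eq_0:
  assumes "finite (verts G)" "card (verts G) \<le> m"
  shows "cube_count G m = 0"
proof -
  have False if H: "induced_subgraph H G" "digraph_iso H (with_proj (hypercube m))" for H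
  proof -
    from H(2) obtain f where f: "pre_digraph.digraph_isomorphism H f"
      "with_proj (hypercube m) = app_iso f H"
      by (auto simp: digraph_iso_def)
    have "pverts (hypercube m) = iso_verts f ` verts H"
      using arg_cong[OF f(2), of verts] by (simp add: verts_app_iso)
    moreover have sub: "verts H \<subseteq> verts G"
      using H(1) by (auto simp: induced_subgraph_def subgraph_def)
    ultimately have "2 ^ m \<le> card (verts G)"
      using card_image_le[of "verts H" "iso_verts f"] card_mono[OF assms(1) sub]
        finite_subset[OF sub assms(1)] card_hypercube[of m] by simp
    then show False using assms(2) less_exp[of m] by linarith
  qed
  then have "{H. induced_subgraph H G \<and> digraph_iso H (with_proj (hypercube m))} = {}"
    by blast
  then show ?thesis unfolding cube_count_def by (simp only: card.empty)
qed

lemma coeff_cube_poly: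
  assumes "finite (verts G)"
  shows "coeff (cube_poly G) m = int (cube_count G m)"
proof -
  have "\<forall>\<^sub>\<infinity>m. int (cube_count G m) = 0"
    unfolding MOST_nat_le using cube_count_eq_0[OF assms] by (metis of_nat_0)
  then show ?thesis by (simp add: cube_poly_def coeff_Abs_poly Abs_poly_inverse)
qed

lemma pair_graph_padovan_graph: "pair_graph (padovan_graph n k)"
proof -
  have "padovan_verts n k \<subseteq> {w. set w \<subseteq> {0, 1} \<and> length w = n}"
    by (auto simp: padovan_verts_def)
  then have fin: "finite (padovan_verts n k)"
    by (rule finite_subset) (simp add: finite_lists_length_eq)
  moreover have "finite (parcs (padovan_graph n k))"
    by (rule finite_subset[of _ "padovan_verts n k \<times> padovan_verts n k"])
       (auto simp: padovan_graph_def fin)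
  ultimately show ?thesis
    by unfold_locales
       (auto simp: padovan_graph_def swap01_def symmetric_def intro: symI)
qed

end

theory Submission
  imports Defs
begin

text \<open>
  A Padovan word is a word in the blocks \<open>01\<close> and \<open>011\<close> followed by \<open>0\<close>, and an edge exchanges two
  neighbouring distinct blocks. Let \<open>S\<close> span an induced cube, and split \<open>S\<close> by the first block. A
  vertex has at most one edge across this cut, so either one side is empty, and the common first
  block can be deleted, or the cut is that of a coordinate of the cube. In the second case every
  vertex has a crossing edge, hence \<open>S\<close> consists of the two orders of a pair of distinct blocks,
  each followed by the same cube of dimension one less. With the block weights \<open>y\<^sup>2z\<close>, \<open>y\<^sup>3z\<^sup>2\<close>
  and the weight \<open>xy\<^sup>5z\<^sup>3\<close> of an exchanged pair, this recursion reads
  \<open>F = y + (y\<^sup>2z + y\<^sup>3z\<^sup>2 + xy\<^sup>5z\<^sup>3) F\<close>.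
\<close>

section \<open>Hypercubes in graphs\<close>

text \<open>Hamming distance one, in a recursive form suited to induction on lists. Lists of
  different lengths are never related.\<close>

fun differ1 :: "'a list \<Rightarrow> 'a list \<Rightarrow> bool" where
  "differ1 (a # u) (b # v) = (if a = b then differ1 u v else u = v)"
| "differ1 _ _ = False"

lemma card_differ_eq_1_iff:
  "length u = length v \<Longrightarrow> card {i. i < length u \<and> u ! i \<noteq> v ! i} = 1 \<longleftrightarrow> differ1 u v"
proof (induction u v rule: list_induct2)
  case (Cons a u b v)
  let ?D = "{i. i < length u \<and> u ! i \<noteq> v ! i}"
  have D: "{i. i < length (a # u) \<and> (a # u) ! i \<noteq> (b # v) ! i} =
    (if a = b then {} else {0}) \<union> Suc ` ?D"
    by (rule set_eqI) (rename_tac i, case_tac i; auto)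
  have "?D = {} \<longleftrightarrow> u = v"
    using Cons.hyps by (auto simp: list_eq_iff_nth_eq)
  then show ?case
    unfolding D using Cons.IH by (auto simp: card_image)
qed simp

lemma differ1_irrefl: "\<not> differ1 u u"
  by (induction u) auto

text \<open>Adjacency is reflected as well as preserved, so the image is an induced cube. The
  relation \<open>E\<close> is arbitrary so that arcs between words and \<open>adj\<close> between
  block lists are covered alike.\<close>

definition cube_embedding :: "('a \<Rightarrow> 'a \<Rightarrow> bool) \<Rightarrow> nat \<Rightarrow> (bit list \<Rightarrow> 'a) \<Rightarrow> bool" where
  "cube_embedding E m g \<longleftrightarrow> inj_on g {u. length u = m} \<and>
     (\<forall>u v. length u = m \<longrightarrow> length v = m \<longrightarrow> (E (g u) (g v) \<longleftrightarrow> differ1 u v))"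

definition is_cube :: "('a \<Rightarrow> 'a \<Rightarrow> bool) \<Rightarrow> nat \<Rightarrow> 'a set \<Rightarrow> bool" where
  "is_cube E m S \<longleftrightarrow> (\<exists>g. cube_embedding E m g \<and> S = g ` {u. length u = m})"

lemma cube_nonempty: "is_cube E m S \<Longrightarrow> S \<noteq> {}"
  unfolding is_cube_def using Ex_list_of_length by blast

text \<open>Embeddings are composed with \<open>e\<close> in one direction and with its inverse on
  \<open>S\<close> in the other; hence the relations need to agree only on \<open>S\<close>.\<close>

lemma is_cube_image:
  assumes inj: "inj_on e S"
    and E: "\<And>s t. s \<in> S \<Longrightarrow> t \<in> S \<Longrightarrow> E (e s) (e t) \<longleftrightarrow> E' s t"
  shows "is_cube E m (e ` S) \<longleftrightarrow> is_cube E' m S"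
proof
  assume "is_cube E' m S"
  then obtain g where g: "cube_embedding E' m g" and S: "S = g ` {u. length u = m}"
    unfolding is_cube_def by blast
  have "cube_embedding E m (e \<circ> g)"
    using g inj E unfolding S cube_embedding_def by (auto intro!: comp_inj_on)
  then show "is_cube E m (e ` S)"
    unfolding is_cube_def S by (auto simp: image_comp)
next
  assume "is_cube E m (e ` S)"
  then obtain g where g: "cube_embedding E m g" and S: "e ` S = g ` {u. length u = m}"
    unfolding is_cube_def by blast
  define h where "h = the_inv_into S e"
  have h: "h (g u) \<in> S" "e (h (g u)) = g u" if "length u = m" for u
  proof -
    have "g u \<in> e ` S" using S that by blast
    then show "h (g u) \<in> S" "e (h (g u)) = g u"
      unfolding h_def using inj by (auto simp: the_inv_into_f_f)
  qed
  have "inj_on (h \<circ> g) {u. length u = m}"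
    by (rule inj_onI) (use g h in \<open>auto simp: cube_embedding_def inj_on_def, metis\<close>)
  moreover have "E' (h (g u)) (h (g v)) \<longleftrightarrow> differ1 u v" if "length u = m" "length v = m" for u v
    using E[of "h (g u)" "h (g v)"] h that g by (simp add: cube_embedding_def)
  moreover have "S = (h \<circ> g) ` {u. length u = m}"
  proof -
    have "S = h ` e ` S" unfolding h_def using inj by (auto simp: the_inv_into_f_f image_iff)
    then show ?thesis unfolding S by (simp add: image_comp)
  qed
  ultimately show "is_cube E' m S"
    unfolding is_cube_def cube_embedding_def by (intro exI[of _ "h \<circ> g"]) auto
qed

text \<open>Transfers the counting of cubes from Padovan words to block lists, with
  \<open>enc\<close> as \<open>e\<close>.\<close>

lemma card_cubes_image:
  assumes inj: "inj_on e V"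
    and E: "\<And>s t. s \<in> V \<Longrightarrow> t \<in> V \<Longrightarrow> E (e s) (e t) \<longleftrightarrow> E' s t"
  shows "card {S. S \<subseteq> e ` V \<and> is_cube E m S} = card {S. S \<subseteq> V \<and> is_cube E' m S}"
proof -
  have iff: "is_cube E m (e ` S) \<longleftrightarrow> is_cube E' m S" if "S \<subseteq> V" for S
    using that E by (intro is_cube_image inj_on_subset[OF inj]) auto
  have "{S. S \<subseteq> e ` V \<and> is_cube E m S} = (`) e ` {S. S \<subseteq> V \<and> is_cube E' m S}"
    using iff by (auto simp: subset_image_iff)
  moreover have "inj_on ((`) e) {S. S \<subseteq> V \<and> is_cube E' m S}"
    by (rule inj_on_subset[OF inj_on_image_Pow[OF inj]]) auto
  ultimately show ?thesis by (simp add: card_image)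
qed

section \<open>Induced hypercubes of a digraph as vertex sets\<close>

lemma hypercube_arcs:
  "parcs (hypercube m) = {(u, v). length u = m \<and> length v = m \<and> differ1 u v}"
  by (auto simp: hypercube_def card_differ_eq_1_iff[symmetric])

text \<open>Arcs on both sides are pairs of endpoints, so the arc map of an isomorphism is
  determined by its vertex map, and only a bijection of vertices respecting adjacency both ways
  remains.\<close>

lemma digraph_iso_hypercube_iff:
  fixes P :: "'a pair_pre_digraph"
  assumes wf: "wf_digraph (with_proj P \<restriction> S)"
  shows "digraph_iso (with_proj P \<restriction> S) (with_proj (hypercube m)) \<longleftrightarrow>
    is_cube (\<lambda>u v. (u, v) \<in> parcs P) m S" (is "?iso \<longleftrightarrow> ?cube")
proof
  assume ?iso
  then obtain f where f: "pre_digraph.digraph_isomorphism (with_proj P \<restriction> S) f"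
    and eq: "with_proj (hypercube m) = app_iso f (with_proj P \<restriction> S)"
    by (auto simp: digraph_iso_def)
  let ?h = "iso_verts f"
  have inj: "inj_on ?h S" "inj_on (iso_arcs f) {e \<in> parcs P. fst e \<in> S \<and> snd e \<in> S}"
    using f by (auto simp: pre_digraph.digraph_isomorphism_def)
  have verts: "{u. length u = m} = ?h ` S"
    using arg_cong[OF eq, of verts] by (simp add: hypercube_verts)
  have arcs: "parcs (hypercube m) = iso_arcs f ` {e \<in> parcs P. fst e \<in> S \<and> snd e \<in> S}"
    using arg_cong[OF eq, of arcs] by simp
  \<comment> \<open>\<open>app_iso\<close> takes the incidence maps of the image graph from
    \<open>f\<close>, and these must be the projections used by the hypercube.\<close>
  have ends: "iso_tail f = fst" "iso_head f = snd"
    using arg_cong[OF eq, of tail] arg_cong[OF eq, of head] by simp_all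
  have arc: "iso_arcs f (s, t) = (?h s, ?h t)" if "(s, t) \<in> parcs P" "s \<in> S" "t \<in> S" for s t
    using f that by (auto simp: pre_digraph.digraph_isomorphism_def ends prod_eq_iff)
  have iff: "differ1 (?h s) (?h t) \<longleftrightarrow> (s, t) \<in> parcs P" if "s \<in> S" "t \<in> S" for s t
  proof -
    have "differ1 (?h s) (?h t) \<longleftrightarrow> (?h s, ?h t) \<in> parcs (hypercube m)"
      using verts that by (auto simp: hypercube_arcs)
    also have "\<dots> \<longleftrightarrow> (s, t) \<in> parcs P"
    proof
      assume "(?h s, ?h t) \<in> parcs (hypercube m)"
      then obtain a b where ab: "(a, b) \<in> parcs P" "a \<in> S" "b \<in> S" "(?h s, ?h t) = iso_arcs f (a, b)"
        unfolding arcs by auto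
      then have "?h s = ?h a" "?h t = ?h b" using arc by auto
      then have "s = a" "t = b" using inj(1) that ab by (auto dest: inj_onD)
      then show "(s, t) \<in> parcs P" using ab by simp
    next
      assume "(s, t) \<in> parcs P"
      then show "(?h s, ?h t) \<in> parcs (hypercube m)"
        unfolding arcs using that arc by (intro image_eqI[of _ _ "(s, t)"]) auto
    qed
    finally show ?thesis .
  qed
  have "is_cube differ1 m (?h ` S)"
    unfolding verts[symmetric] is_cube_def cube_embedding_def by (intro exI[of _ id]) auto
  then show ?cube
    using is_cube_image[OF inj(1), of differ1 "\<lambda>u v. (u, v) \<in> parcs P"] iff by simp
next
  assume ?cube
  then obtain g where g: "cube_embedding (\<lambda>u v. (u, v) \<in> parcs P) m g"
    and S: "S = g ` {u. length u = m}"
    unfolding is_cube_def by blast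
  have inj: "inj_on g {u. length u = m}" using g by (simp add: cube_embedding_def)
  define h where "h = the_inv_into {u. length u = m} g"
  have h: "h (g u) = u" if "length u = m" for u
    unfolding h_def using the_inv_into_f_f[OF inj] that by simp
  define f where "f = \<lparr> iso_verts = h, iso_arcs = map_prod h h, iso_head = snd, iso_tail = fst \<rparr>"
  have "inj_on h S" unfolding S by (auto simp: inj_on_def h)
  then have inj_f: "inj_on (map_prod h h) (S \<times> S)" by (rule map_prod_inj_on) fact
  have "pre_digraph.digraph_isomorphism (with_proj P \<restriction> S) f"
    unfolding pre_digraph.digraph_isomorphism_def
    using wf \<open>inj_on h S\<close> by (auto simp: f_def intro!: inj_on_subset[OF inj_f])
  moreover have "h ` S = {u. length u = m}"
    unfolding S by (auto simp: h image_iff)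
  moreover have "map_prod h h ` {e \<in> parcs P. fst e \<in> S \<and> snd e \<in> S} = parcs (hypercube m)"
  proof (intro equalityI subsetI)
    fix e assume "e \<in> map_prod h h ` {e \<in> parcs P. fst e \<in> S \<and> snd e \<in> S}"
    then show "e \<in> parcs (hypercube m)"
      using g unfolding S hypercube_arcs cube_embedding_def by (auto simp: h)
  next
    fix e assume "e \<in> parcs (hypercube m)"
    then obtain u v where e: "e = (u, v)" "length u = m" "length v = m" "differ1 u v"
      unfolding hypercube_arcs by auto
    then have "(g u, g v) \<in> parcs P" "g u \<in> S" "g v \<in> S"
      using g unfolding S cube_embedding_def by auto
    then show "e \<in> map_prod h h ` {e \<in> parcs P. fst e \<in> S \<and> snd e \<in> S}"
      using e h by (intro image_eqI[of _ _ "(g u, g v)"]) auto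
  qed
  ultimately have "pre_digraph.digraph_isomorphism (with_proj P \<restriction> S) f"
    "with_proj (hypercube m) = app_iso f (with_proj P \<restriction> S)"
    by (auto simp: app_iso_def f_def with_proj_def hypercube_verts)
  then show ?iso unfolding digraph_iso_def by blast
qed

text \<open>An induced subgraph is the restriction to its own vertex set, so restriction is a
  bijection from the vertex sets that are cubes to the subgraphs counted.\<close>

lemma cube_count_pair_digraph:
  fixes P :: "'a pair_pre_digraph"
  assumes "pair_wf_digraph P"
  shows "cube_count (with_proj P) m =
    card {S. S \<subseteq> pverts P \<and> is_cube (\<lambda>u v. (u, v) \<in> parcs P) m S}"
proof -
  interpret wf: wf_digraph "with_proj P" using assms by (simp add: wf_digraph_wp_iff)
  have ind: "induced_subgraph (with_proj P \<restriction> S) (with_proj P)" if "S \<subseteq> pverts P" for S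
    using that by (intro wf.induced_induce) simp
  have iso: "digraph_iso (with_proj P \<restriction> S) (with_proj (hypercube m)) \<longleftrightarrow>
      is_cube (\<lambda>u v. (u, v) \<in> parcs P) m S" for S
    by (intro digraph_iso_hypercube_iff wf.wellformed_induce_subgraph)
  have "{H. induced_subgraph H (with_proj P) \<and> digraph_iso H (with_proj (hypercube m))} =
    (\<restriction>) (with_proj P) ` {S. S \<subseteq> pverts P \<and> is_cube (\<lambda>u v. (u, v) \<in> parcs P) m S}"
  proof (intro equalityI subsetI)
    fix H assume "H \<in> {H. induced_subgraph H (with_proj P) \<and> digraph_iso H (with_proj (hypercube m))}"
    then have H: "induced_subgraph H (with_proj P)" "digraph_iso H (with_proj (hypercube m))"
      by auto
    have sub: "verts H \<subseteq> pverts P"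
      using H(1) by (auto simp: induced_subgraph_def subgraph_def)
    have "H = with_proj P \<restriction> verts H"
      by (rule induced_subgraph_eqI[OF H(1) ind[OF sub]]) simp
    then show "H \<in> (\<restriction>) (with_proj P) ` {S. S \<subseteq> pverts P \<and> is_cube (\<lambda>u v. (u, v) \<in> parcs P) m S}"
      using H(2) sub iso by (metis (mono_tags, lifting) image_eqI mem_Collect_eq)
  qed (use ind iso in auto)
  moreover have "inj_on ((\<restriction>) (with_proj P)) A" for A
    by (rule inj_onI) (metis induce_subgraph_verts)
  ultimately show ?thesis unfolding cube_count_def by (simp add: card_image)
qed

section \<open>Cuts of a hypercube\<close>

text \<open>Connectedness of the cube as an invariance principle. The tail is changed first, inside
  the face with head \<open>a\<close>, and then at most one edge changes the head.\<close>

lemma bit_cube_connected: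
  fixes R :: "bit list \<Rightarrow> bool"
  assumes "\<And>u v. length u = m \<Longrightarrow> length v = m \<Longrightarrow> differ1 u v \<Longrightarrow> R u \<Longrightarrow> R v"
    and "length u = m" "length v = m" "R u"
  shows "R v"
  using assms
proof (induction m arbitrary: R u v)
  case (Suc m)
  obtain a u' b v' where uv: "u = a # u'" "v = b # v'" "length u' = m" "length v' = m"
    using Suc.prems(2,3) by (auto simp: length_Suc_conv)
  have "R (a # v')"
  proof (rule Suc.IH[where R = "\<lambda>w. R (a # w)"])
    show "R (a # w')" if "length w = m" "length w' = m" "differ1 w w'" "R (a # w)" for w w'
      using Suc.prems(1)[of "a # w" "a # w'"] that by simp
  qed (use Suc.prems(4) uv in auto)
  then show ?case
    using Suc.prems(1)[of "a # v'" v] uv by (cases "a = b") auto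
qed simp

text \<open>The edges in direction \<open>i\<close> are the pairs \<open>insert_at i a w\<close>,
  \<open>insert_at i b w\<close> with \<open>a\<close> and \<open>b\<close> distinct;
  \<open>w\<close> runs through the class of parallel edges.\<close>

definition insert_at :: "nat \<Rightarrow> 'a \<Rightarrow> 'a list \<Rightarrow> 'a list" where
  "insert_at i a u = take i u @ a # drop i u"

lemma length_insert_at [simp]: "length (insert_at i a u) = Suc (length u)"
  by (simp add: insert_at_def)

lemma insert_at_inject:
  "length u = length v \<Longrightarrow> insert_at i a u = insert_at i b v \<longleftrightarrow> a = b \<and> u = v"
  by (auto simp: insert_at_def) (metis append_take_drop_id)+

lemma differ1_insert_at:
  "length u = length v \<Longrightarrow>
    differ1 (insert_at i a u) (insert_at i b v) \<longleftrightarrow> (if a = b then differ1 u v else u = v)"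
proof (induction u v arbitrary: i rule: list_induct2)
  case Nil
  then show ?case by (simp add: insert_at_def)
next
  case (Cons c u d v)
  show ?case
  proof (cases i)
    case 0
    then show ?thesis by (simp add: insert_at_def)
  next
    case (Suc j)
    then have *: "insert_at i x (y # w) = y # insert_at j x w" for x y w
      by (simp add: insert_at_def)
    show ?thesis unfolding * using Cons.IH[of j] insert_at_inject[OF Cons.hyps] by auto
  qed
qed

lemma differ1_obtain:
  assumes "length u = length v" "differ1 u v"
  obtains i a b w where "i \<le> length w" "a \<noteq> b" "u = insert_at i a w" "v = insert_at i b w"
proof -
  have "\<exists>p a b w. a \<noteq> b \<and> u = p @ a # w \<and> v = p @ b # w"
    using assms
  proof (induction u v rule: list_induct2)
    case (Cons c u d v)
    show ?case
    proof (cases "c = d")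
      case True
      then obtain p a b w where "a \<noteq> b" "u = p @ a # w" "v = p @ b # w"
        using Cons by auto
      then show ?thesis
        using True by (intro exI[of _ "c # p"] exI[of _ a] exI[of _ b] exI[of _ w]) simp
    next
      case False
      then show ?thesis
        using Cons.prems by (intro exI[of _ "[]"] exI[of _ c] exI[of _ d] exI[of _ u]) simp
    qed
  qed simp
  then obtain p a b w where "a \<noteq> b" "u = p @ a # w" "v = p @ b # w" by blast
  then show thesis using that[of "length p" "p @ w" a b] by (simp add: insert_at_def)
qed

lemma insert_at_surj:
  assumes "length u = Suc m" "i \<le> m"
  obtains c w where "length w = m" "u = insert_at i c w"
proof
  show "length (take i u @ drop (Suc i) u) = m" using assms by simp
  show "u = insert_at i (u ! i) (take i u @ drop (Suc i) u)"
    using assms by (simp add: insert_at_def id_take_nth_drop)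
qed

text \<open>A crossing edge forces all its parallel edges to cross: walking to a neighbouring edge of the
  same direction, both endpoints keep their side because their one crossing edge is used up.\<close>

lemma matching_cut:
  fixes P :: "bit list \<Rightarrow> bool"
  assumes matching: "\<And>u v w. length u = m \<Longrightarrow> length v = m \<Longrightarrow> length w = m \<Longrightarrow>
      differ1 u v \<Longrightarrow> differ1 u w \<Longrightarrow> P u \<noteq> P v \<Longrightarrow> P u \<noteq> P w \<Longrightarrow> v = w"
    and mixed: "length u0 = m" "P u0" "length v0 = m" "\<not> P v0"
  obtains m' i a b where "m = Suc m'" "i \<le> m'" "a \<noteq> b"
    "\<And>w. length w = m' \<Longrightarrow> P (insert_at i a w)" "\<And>w. length w = m' \<Longrightarrow> \<not> P (insert_at i b w)"
proof -
  obtain u v where uv: "length u = m" "length v = m" "differ1 u v" "P u" "\<not> P v"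
    using bit_cube_connected[of m P u0 v0] mixed by blast
  obtain i a b w where w: "i \<le> length w" "a \<noteq> b" "u = insert_at i a w" "v = insert_at i b w"
    using differ1_obtain[of u v] uv by metis
  define R where "R t \<longleftrightarrow> P (insert_at i a t) \<and> \<not> P (insert_at i b t)" for t
  have R: "R t" if "length t = length w" for t
  proof (rule bit_cube_connected[where R = R and u = w and m = "length w"])
    show "R w" using uv w by (simp add: R_def)
  next
    fix s t :: "bit list" assume st: "length s = length w" "length t = length w" "differ1 s t" "R s"
    have m: "m = Suc (length w)" using uv(1) w(3) by simp
    have "s \<noteq> t" using st(3) differ1_irrefl by blast
    have "P (insert_at i a t)"
      using matching[of "insert_at i a s" "insert_at i b s" "insert_at i a t"] st w(2) \<open>s \<noteq> t\<close>
      by (auto simp: differ1_insert_at insert_at_inject m R_def)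
    moreover have "\<not> P (insert_at i b t)"
      using matching[of "insert_at i b s" "insert_at i a s" "insert_at i b t"] st w(2) \<open>s \<noteq> t\<close>
      by (auto simp: differ1_insert_at insert_at_inject m R_def)
    ultimately show "R t" by (simp add: R_def)
  qed (use that in auto)
  show thesis
    using that[of "length w" i a b] R w uv by (auto simp: R_def)
qed

section \<open>Block words\<close>

fun enc :: "bool list \<Rightarrow> bit list" where
  "enc [] = [0]"
| "enc (False # s) = 0 # 1 # enc s"
| "enc (True # s) = 0 # 1 # 1 # enc s"

text \<open>The directed move from \<open>01 011\<close> to \<open>011 01\<close>. On letters,
  \<open>01011\<close> becomes \<open>01101\<close>, which replaces the middle \<open>01\<close> by
  \<open>10\<close>.\<close>

fun step :: "bool list \<Rightarrow> bool list \<Rightarrow> bool" where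
  "step (a # s) (b # t) =
     (if a = b then step s t else \<not> a \<and> (\<exists>r. s = True # r \<and> t = False # r))"
| "step _ _ = False"

definition adj :: "bool list \<Rightarrow> bool list \<Rightarrow> bool" where
  "adj s t \<longleftrightarrow> step s t \<or> step t s"

section \<open>Unique decoding, and letter swaps as block exchanges\<close>

lemma enc_0: "\<exists>w. enc s = 0 # w"
  by (cases s rule: enc.cases) auto

lemma enc_not_1 [simp]: "enc s \<noteq> 1 # w" "1 # w \<noteq> enc s"
  using enc_0[of s] by auto

lemma enc_not_0_enc [simp]: "enc s \<noteq> 0 # enc t"
  using enc_0[of t] by (cases s rule: enc.cases) auto

lemma inj_enc: "inj enc"
proof (rule injI)
  show "enc s = enc t \<Longrightarrow> s = t" for s t
  proof (induction s arbitrary: t rule: enc.induct)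
    case 1
    then show ?case by (cases t rule: enc.cases) auto
  next
    case (2 s)
    then show ?case by (cases t rule: enc.cases) auto
  next
    case (3 s)
    then show ?case by (cases t rule: enc.cases) auto
  qed
qed

text \<open>Turns the existential over prefixes into a recursion on the first letter: the prefix
  before the swapped pair is either nonempty or empty.\<close>

lemma swap01_Cons:
  "swap01 (a # u) (b # v) \<longleftrightarrow>
    (a = b \<and> swap01 u v) \<or> (a = 0 \<and> b = 1 \<and> (\<exists>s. u = 1 # s \<and> v = 0 # s))"
  (is "?L \<longleftrightarrow> ?R")
proof
  assume ?L
  then obtain p s where "a # u = p @ [0, 1] @ s" "b # v = p @ [1, 0] @ s"
    unfolding swap01_def by blast
  then show ?R by (cases p) (auto simp: swap01_def)
next
  assume ?R
  then show ?L
  proof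
    assume "a = b \<and> swap01 u v"
    then obtain p s where "a = b" "u = p @ [0, 1] @ s" "v = p @ [1, 0] @ s"
      unfolding swap01_def by blast
    then show ?L
      unfolding swap01_def by (intro exI[of _ "a # p"] exI[of _ s]) simp
  next
    assume "a = 0 \<and> b = 1 \<and> (\<exists>s. u = 1 # s \<and> v = 0 # s)"
    then show ?L
      unfolding swap01_def by (auto intro: exI[of _ "[]"])
  qed
qed

lemma swap01_Nil [simp]: "\<not> swap01 [] v" "\<not> swap01 u []"
  by (auto simp: swap01_def)

text \<open>The situation after cancelling \<open>01\<close> from a short and a long first block.
  The first letters differ, so the swap happens there; if \<open>s\<close> began with a short block,
  the code of \<open>t\<close> would begin with \<open>00\<close>.\<close>

lemma swap01_short_long:
  "swap01 (enc s) (1 # enc t) \<longleftrightarrow> (\<exists>r. s = True # r \<and> t = False # r)"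
proof (cases s rule: enc.cases)
  case (2 r)
  then show ?thesis using enc_0[of r] by (auto simp: swap01_Cons)
next
  case (3 r)
  then show ?thesis
    by (cases t rule: enc.cases) (auto simp: swap01_Cons inj_eq[OF inj_enc])
qed (simp add: swap01_Cons)

lemma swap01_long_short: "\<not> swap01 (1 # enc s) (enc t)"
  using enc_0[of t] by (auto simp: swap01_Cons)

text \<open>Equal first blocks cancel. Unequal ones leave a code facing a code preceded by an extra
  \<open>1\<close>, and the two preceding lemmas settle both orientations.\<close>

lemma swap01_enc: "swap01 (enc s) (enc t) \<longleftrightarrow> step s t"
proof (induction s arbitrary: t rule: enc.induct)
  case 1
  then show ?case using enc_0[of t] by (auto simp: swap01_Cons)
next
  case (2 s)
  then show ?case
    by (cases t rule: enc.cases) (simp_all add: swap01_Cons swap01_short_long)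
next
  case (3 s)
  then show ?case
    by (cases t rule: enc.cases) (simp_all add: swap01_Cons swap01_long_short)
qed

section \<open>Padovan words are exactly the codes of block lists\<close>

lemma padovan_01:
  "padovan (0 # 1 # 0 # w) \<longleftrightarrow> padovan (0 # w)"
  "padovan (0 # 1 # 1 # 0 # w) \<longleftrightarrow> padovan (0 # w)"
  by (auto simp: padovan_def sublist_Cons_right)

lemma padovan_enc: "padovan (enc s)"
proof (induction s rule: enc.induct)
  case 1
  then show ?case by (simp add: padovan_def sublist_Cons_right)
next
  case (2 s)
  then show ?case using enc_0[of s] by (auto simp: padovan_01)
next
  case (3 s)
  then show ?case using enc_0[of s] by (auto simp: padovan_01)
qed

text \<open>After the leading \<open>0\<close> the word ends or continues with one or two letters
  \<open>1\<close> and then \<open>0\<close>, because \<open>00\<close> and \<open>111\<close> are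
  excluded and the last letter is \<open>0\<close>. This \<open>0\<close> starts a shorter Padovan
  word.\<close>

lemma padovan_imp_enc: "padovan w \<Longrightarrow> w \<in> range enc"
proof (induction w rule: length_induct)
  case (1 w)
  consider "w = [0]" | v where "w = 0 # 1 # 0 # v" | v where "w = 0 # 1 # 1 # 0 # v"
  proof -
    obtain w1 where w1: "w = 0 # w1" using 1(2) by (cases w) (auto simp: padovan_def)
    show thesis
    proof (cases w1)
      case Nil
      then show thesis using w1 that by simp
    next
      case (Cons b w2)
      then have b: "b = 1" using 1(2) w1
        by (cases b) (auto simp: padovan_def sublist_Cons_right)
      show thesis
      proof (cases w2)
        case Nil
        then show thesis using 1(2) w1 Cons b by (simp add: padovan_def)
      next
        case w2: (Cons c w3)
        show thesis
        proof (cases c)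
          case zero
          then show thesis using that w1 Cons b w2 by simp
        next
          case one
          show thesis
          proof (cases w3)
            case Nil
            then show thesis using 1(2) w1 Cons b w2 one by (simp add: padovan_def)
          next
            case w3: (Cons d w4)
            then have "d = 0" using 1(2) w1 Cons b w2 one
              by (cases d) (auto simp: padovan_def sublist_Cons_right)
            then show thesis using that w1 Cons b w2 one w3 by simp
          qed
        qed
      qed
    qed
  qed
  then show ?case
  proof cases
    case 1
    then show ?thesis using rangeI[of enc "[]"] by simp
  next
    case (2 v)
    then obtain s where "0 # v = enc s" using 1 by (force simp: padovan_01)
    then show ?thesis using 2 rangeI[of enc "False # s"] by simp
  next
    case (3 v)
    then obtain s where "0 # v = enc s" using 1 by (force simp: padovan_01)
    then show ?thesis using 3 rangeI[of enc "True # s"] by simp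
  qed
qed

definition blocks :: "nat \<Rightarrow> nat \<Rightarrow> bool list set" where
  "blocks n k = {s. length (enc s) = n \<and> count_list (enc s) 1 = k}"

text \<open>With \<open>a\<close> short and \<open>b\<close> long blocks the length is
  \<open>2 * a + 3 * b + 1\<close> and the number of ones is \<open>a + 2 * b\<close>. Hence the
  range condition in \<open>padovan_verts\<close> excludes no Padovan word.\<close>

lemma enc_length_count:
  "1 \<le> length (enc s) \<and> length (enc s) div 2 \<le> count_list (enc s) 1 \<and>
    count_list (enc s) 1 \<le> (2 * length (enc s) - 2) div 3"
proof -
  have "\<exists>a b. length (enc s) = 2 * a + 3 * b + 1 \<and> count_list (enc s) 1 = a + 2 * b"
  proof (induction s rule: enc.induct)
    case (2 s)
    then obtain a b where "length (enc s) = 2 * a + 3 * b + 1" "count_list (enc s) 1 = a + 2 * b"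
      by blast
    then show ?case by (intro exI[of _ "Suc a"] exI[of _ b]) simp
  next
    case (3 s)
    then obtain a b where "length (enc s) = 2 * a + 3 * b + 1" "count_list (enc s) 1 = a + 2 * b"
      by blast
    then show ?case by (intro exI[of _ a] exI[of _ "Suc b"]) simp
  qed simp
  then obtain a b where "length (enc s) = 2 * a + 3 * b + 1" "count_list (enc s) 1 = a + 2 * b"
    by blast
  then show ?thesis by (auto; presburger)
qed

lemma padovan_verts_eq: "padovan_verts n k = enc ` blocks n k"
proof -
  have "padovan_verts n k = {w. padovan w \<and> length w = n \<and> count_list w 1 = k}"
    using enc_length_count padovan_imp_enc unfolding padovan_verts_def by (auto split: if_splits)
  also have "\<dots> = enc ` blocks n k"
    using padovan_imp_enc padovan_enc by (auto simp: blocks_def)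
  finally show ?thesis .
qed

lemma blocks_iff:
  "[] \<in> blocks n k \<longleftrightarrow> n = 1 \<and> k = 0"
  "False # s \<in> blocks n k \<longleftrightarrow> 2 \<le> n \<and> 1 \<le> k \<and> s \<in> blocks (n - 2) (k - 1)"
  "True # s \<in> blocks n k \<longleftrightarrow> 3 \<le> n \<and> 2 \<le> k \<and> s \<in> blocks (n - 3) (k - 2)"
  by (auto simp: blocks_def)

text \<open>Both orders of two distinct blocks have the same weight, so an exchange stays inside one
  graph.\<close>

lemma blocks_two_iff:
  "False # True # s \<in> blocks n k \<longleftrightarrow> 5 \<le> n \<and> 3 \<le> k \<and> s \<in> blocks (n - 5) (k - 3)"
  "True # False # s \<in> blocks n k \<longleftrightarrow> 5 \<le> n \<and> 3 \<le> k \<and> s \<in> blocks (n - 5) (k - 3)"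
  by (auto simp: blocks_def)

lemma finite_blocks: "finite (blocks n k)"
proof -
  have "length s \<le> length (enc s)" for s
    by (induction s rule: enc.induct) auto
  then have "blocks n k \<subseteq> {s. set s \<subseteq> UNIV \<and> length s \<le> n}"
    by (auto simp: blocks_def)
  then show ?thesis
    by (rule finite_subset[OF _ finite_lists_length_le]) simp
qed

section \<open>Cubes of block words\<close>

definition cubes :: "nat \<Rightarrow> nat \<Rightarrow> nat \<Rightarrow> bool list set set" where
  "cubes n k m = {S. S \<subseteq> blocks n k \<and> is_cube adj m S}"

lemma cube_count_padovan_graph:
  "cube_count (with_proj (padovan_graph n k)) m = card (cubes n k m)"
proof -
  interpret pair_graph "padovan_graph n k" by (rule pair_graph_padovan_graph)
  have "pverts (padovan_graph n k) = enc ` blocks n k"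
    by (simp add: padovan_graph_def padovan_verts_eq)
  moreover have "(enc s, enc t) \<in> parcs (padovan_graph n k) \<longleftrightarrow> adj s t"
    if "s \<in> blocks n k" "t \<in> blocks n k" for s t
    using that by (auto simp: padovan_graph_def padovan_verts_eq swap01_enc adj_def)
  ultimately show ?thesis
    unfolding cubes_def cube_count_pair_digraph[OF pair_wf_digraph_axioms]
    using card_cubes_image[OF inj_on_subset[OF inj_enc subset_UNIV]] by simp
qed

lemma finite_cubes: "finite (cubes n k m)"
  using finite_blocks by (simp add: cubes_def)

text \<open>The prism over \<open>S\<close>: two copies, joined by the exchange of the first two
  blocks.\<close>

definition twin :: "bool list set \<Rightarrow> bool list set" where
  "twin S = (\<lambda>s. False # True # s) ` S \<union> (\<lambda>s. True # False # s) ` S"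

lemma adj_Cons_same: "adj (a # s) (a # t) \<longleftrightarrow> adj s t"
  by (simp add: adj_def)

text \<open>An endpoint of an edge that changes the first block determines the other endpoint, so
  these edges form a matching.\<close>

lemma adj_Cons_neq:
  "adj (False # s) (True # t) \<longleftrightarrow> (\<exists>r. s = True # r \<and> t = False # r)"
  "adj (True # s) (False # t) \<longleftrightarrow> (\<exists>r. s = False # r \<and> t = True # r)"
  by (auto simp: adj_def)

lemma is_cube_image_Cons: "is_cube adj m (Cons a ` S) \<longleftrightarrow> is_cube adj m S"
  by (rule is_cube_image) (auto simp: adj_Cons_same)

text \<open>The new first coordinate selects the order of the exchanged pair. Words from different
  copies are adjacent only if their remainders agree.\<close>

lemma is_cube_twin:
  assumes "is_cube adj m S"
  shows "is_cube adj (Suc m) (twin S)"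
proof -
  obtain g where g: "cube_embedding adj m g" and S: "S = g ` {u. length u = m}"
    using assms unfolding is_cube_def by blast
  define h where
    "h u = (if hd u = 0 then False # True # g (tl u) else True # False # g (tl u))" for u :: "bit list"
  have inj: "g u = g v \<longleftrightarrow> u = v" if "length u = m" "length v = m" for u v
    using g that by (auto simp: cube_embedding_def inj_on_def)
  have g': "adj (g u) (g v) \<longleftrightarrow> differ1 u v" if "length u = m" "length v = m" for u v
    using g that by (auto simp: cube_embedding_def)
  have Q: "{u. length u = Suc m} = Cons 0 ` {u :: bit list. length u = m} \<union> Cons 1 ` {u. length u = m}"
    by (auto simp: length_Suc_conv image_iff)
  have "cube_embedding adj (Suc m) h"
    unfolding cube_embedding_def
  proof (intro conjI allI impI)
    show "inj_on h {u. length u = Suc m}"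
      by (auto simp: inj_on_def Q h_def inj)
    fix u v :: "bit list" assume "length u = Suc m" "length v = Suc m"
    then obtain a u' b v' where uv: "u = a # u'" "v = b # v'" "length u' = m" "length v' = m"
      by (auto simp: length_Suc_conv)
    show "adj (h u) (h v) \<longleftrightarrow> differ1 u v"
      by (cases a; cases b) (auto simp: uv h_def adj_Cons_same adj_Cons_neq g' inj)
  qed
  moreover have "twin S = h ` {u. length u = Suc m}"
  proof -
    have "h (0 # u) = False # True # g u" "h (1 # u) = True # False # g u" for u
      by (simp_all add: h_def)
    then show ?thesis unfolding Q twin_def S by (simp add: image_Un image_image)
  qed
  ultimately show ?thesis unfolding is_cube_def by blast
qed

text \<open>The split by first block is a matching cut, hence a coordinate cut. So every vertex has
  a crossing edge, which fixes its first two blocks and gives both ends the same remainder.\<close>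

lemma mixed_cube:
  assumes "is_cube adj m S" "False # s0 \<in> S" "True # t0 \<in> S" "[] \<notin> S"
  obtains m' S' where "m = Suc m'" "S = twin S'" "is_cube adj m' S'"
proof -
  obtain g where g: "cube_embedding adj m g" and S: "S = g ` {u. length u = m}"
    using assms unfolding is_cube_def by blast
  have inj: "g u = g v \<longleftrightarrow> u = v" if "length u = m" "length v = m" for u v
    using g that by (auto simp: cube_embedding_def inj_on_def)
  have g': "adj (g u) (g v) \<longleftrightarrow> differ1 u v" if "length u = m" "length v = m" for u v
    using g that by (auto simp: cube_embedding_def)
  have ne: "g u \<noteq> []" if "length u = m" for u
    using assms(4) that unfolding S by force
  have swap: "\<exists>r. s = x # (\<not> x) # r \<and> t = (\<not> x) # x # r"
    if "adj s t" "s \<noteq> []" "t \<noteq> []" "hd s = x" "hd t \<noteq> x" for s t x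
    using that by (cases s; cases t; cases x) (auto simp: adj_Cons_neq)
  obtain u0 where u0: "False # s0 = g u0" "u0 \<in> {u. length u = m}"
    using assms(2) unfolding S by (rule imageE)
  obtain v0 where v0: "True # t0 = g v0" "v0 \<in> {u. length u = m}"
    using assms(3) unfolding S by (rule imageE)
  obtain m' i a b where m: "m = Suc m'" "i \<le> m'" "a \<noteq> b"
    and a: "\<And>w. length w = m' \<Longrightarrow> \<not> hd (g (insert_at i a w))"
    and b: "\<And>w. length w = m' \<Longrightarrow> \<not> \<not> hd (g (insert_at i b w))"
  \<comment> \<open>The two sides are the words starting with a short and with a long block. By
    \<open>swap\<close>, \<open>g v\<close> and \<open>g w\<close> both arise from
    \<open>g u\<close> by exchanging its first two blocks.\<close>
  proof (rule matching_cut[of m "\<lambda>u. \<not> hd (g u)" u0 v0])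
    fix u v w :: "bit list"
    assume len: "length u = m" "length v = m" "length w = m"
      and "differ1 u v" "differ1 u w" "(\<not> hd (g u)) \<noteq> (\<not> hd (g v))" "(\<not> hd (g u)) \<noteq> (\<not> hd (g w))"
    then have "\<exists>r. g u = hd (g u) # (\<not> hd (g u)) # r \<and> g v = (\<not> hd (g u)) # hd (g u) # r"
      "\<exists>r. g u = hd (g u) # (\<not> hd (g u)) # r \<and> g w = (\<not> hd (g u)) # hd (g u) # r"
      by (intro swap; simp add: g' ne)+
    then have "g v = g w" by (metis list.inject)
    then show "v = w" using inj len by simp
  qed (use u0(2) v0(2) in \<open>simp_all flip: u0(1) v0(1)\<close>)
  \<comment> \<open>The remainder shared by the two ends of the crossing edge indexed by
    \<open>w\<close>.\<close>
  define h where "h w = tl (tl (g (insert_at i a w)))" for w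
  have h: "g (insert_at i a w) = False # True # h w" "g (insert_at i b w) = True # False # h w"
    if len: "length w = m'" for w
  proof -
    have "adj (g (insert_at i a w)) (g (insert_at i b w))"
      using len m by (simp add: g' differ1_insert_at)
    then obtain r where "g (insert_at i a w) = False # True # r" "g (insert_at i b w) = True # False # r"
      using swap[of "g (insert_at i a w)" "g (insert_at i b w)" False] a b ne len m(1)
      by auto
    then show "g (insert_at i a w) = False # True # h w" "g (insert_at i b w) = True # False # h w"
      by (simp_all add: h_def)
  qed
  have "cube_embedding adj m' h"
    unfolding cube_embedding_def
  proof (intro conjI allI impI)
    show "inj_on h {u. length u = m'}"
    proof (rule inj_onI)
      fix u v assume uv: "u \<in> {u. length u = m'}" "v \<in> {u. length u = m'}" "h u = h v"
      then have "g (insert_at i a u) = g (insert_at i a v)" by (simp add: h)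
      then show "u = v" using uv m by (simp add: inj insert_at_inject)
    qed
    fix u v :: "bit list" assume uv: "length u = m'" "length v = m'"
    have "adj (h u) (h v) \<longleftrightarrow> adj (g (insert_at i a u)) (g (insert_at i a v))"
      using uv by (simp add: h adj_Cons_same)
    also have "\<dots> \<longleftrightarrow> differ1 u v"
      using uv m by (simp add: g' differ1_insert_at)
    finally show "adj (h u) (h v) \<longleftrightarrow> differ1 u v" .
  qed
  then have "is_cube adj m' (h ` {u. length u = m'})"
    unfolding is_cube_def by blast
  moreover have "S = twin (h ` {u. length u = m'})"
  proof -
    have "{u. length u = m} = insert_at i a ` {w. length w = m'} \<union> insert_at i b ` {w. length w = m'}"
    proof (intro equalityI subsetI)
      fix u :: "bit list" assume "u \<in> {u. length u = m}"
      then have "length u = Suc m'" using m(1) by simp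
      then obtain c w where "length w = m'" "u = insert_at i c w"
        using m(2) by (rule insert_at_surj)
      moreover have "c = a \<or> c = b" using m(3) by (cases a; cases b; cases c) auto
      ultimately show "u \<in> insert_at i a ` {w. length w = m'} \<union> insert_at i b ` {w. length w = m'}"
        by auto
    qed (use m in auto)
    then show ?thesis
      unfolding S twin_def by (simp add: image_Un image_image h)
  qed
  ultimately show thesis using that m(1) by blast
qed

text \<open>The four families are the single word without blocks, the cubes with common first block
  short or long, and the prisms. The numeric guards keep the truncated subtractions exact.\<close>

lemma cubes_decomp:
  "cubes n k m =
    ((if n = 1 \<and> k = 0 \<and> m = 0 then {{[]}} else {}) \<union>
     (if 2 \<le> n \<and> 1 \<le> k then (`) (Cons False) ` cubes (n - 2) (k - 1) m else {})) \<union>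
    ((if 3 \<le> n \<and> 2 \<le> k then (`) (Cons True) ` cubes (n - 3) (k - 2) m else {}) \<union>
     (if 5 \<le> n \<and> 3 \<le> k \<and> 1 \<le> m then twin ` cubes (n - 5) (k - 3) (m - 1) else {}))"
  (is "_ = (?A \<union> ?B) \<union> (?C \<union> ?D)")
proof (intro equalityI subsetI)
  fix S assume "S \<in> cubes n k m"
  then have sub: "S \<subseteq> blocks n k" and cube: "is_cube adj m S" by (auto simp: cubes_def)
  obtain s where s: "s \<in> S" using cube_nonempty[OF cube] by blast
  consider "[] \<in> S" | "[] \<notin> S" "\<forall>s\<in>S. \<not> hd s" | "[] \<notin> S" "\<forall>s\<in>S. hd s"
    | s t where "[] \<notin> S" "s \<in> S" "\<not> hd s" "t \<in> S" "hd t" by blast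
  then show "S \<in> (?A \<union> ?B) \<union> (?C \<union> ?D)"
  proof cases
    case 1
    then have nk: "n = 1" "k = 0" using sub blocks_iff(1) by blast+
    have "blocks 1 0 \<subseteq> {[]}"
    proof
      show "s \<in> blocks 1 0 \<Longrightarrow> s \<in> {[]}" for s
        by (cases s rule: enc.cases) (auto simp: blocks_def)
    qed
    then have S: "S = {[]}" using sub 1 nk by auto
    \<comment> \<open>A cube of dimension \<open>m\<close> has \<open>2 ^ m\<close> vertices, so a
      single vertex forces \<open>m = 0\<close>.\<close>
    obtain g where g: "inj_on g {u :: bit list. length u = m}" "S = g ` {u. length u = m}"
      using cube unfolding is_cube_def cube_embedding_def by blast
    have "card {u :: bit list. length u = m} = card S"
      unfolding g(2) using card_image[OF g(1)] by simp
    also have "\<dots> = 1" using S by simp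
    finally have "card {u :: bit list. length u = m} = 1" .
    then have "m = 0" using card_hypercube[of m] by (cases m) (auto simp: hypercube_verts)
    then show ?thesis using S nk by simp
  next
    case 2
    have "False # tl s = s" if "s \<in> S" for s using 2 that by (cases s) auto
    then have S: "S = Cons False ` (tl ` S)" by (simp add: image_image)
    then have *: "is_cube adj m (tl ` S)" using cube is_cube_image_Cons by metis
    have "False # t \<in> blocks n k" if "t \<in> tl ` S" for t using S sub that by blast
    \<comment> \<open>The bounds on \<open>n\<close> and \<open>k\<close> come from an actual
      element of the cube.\<close>
    then have "2 \<le> n \<and> 1 \<le> k" "tl ` S \<subseteq> blocks (n - 2) (k - 1)"
      using s by (auto simp: blocks_iff)
    then show ?thesis using S * by (auto simp: cubes_def)
  next
    case 3
    have "True # tl s = s" if "s \<in> S" for s using 3 that by (cases s) auto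
    then have S: "S = Cons True ` (tl ` S)" by (simp add: image_image)
    then have *: "is_cube adj m (tl ` S)" using cube is_cube_image_Cons by metis
    have "True # t \<in> blocks n k" if "t \<in> tl ` S" for t using S sub that by blast
    then have "3 \<le> n \<and> 2 \<le> k" "tl ` S \<subseteq> blocks (n - 3) (k - 2)"
      using s by (auto simp: blocks_iff)
    then show ?thesis using S * by (auto simp: cubes_def)
  next
    case (4 s t)
    then have "False # tl s \<in> S" "True # tl t \<in> S" by (metis list.collapse)+
    then obtain m' S' where S': "m = Suc m'" "S = twin S'" "is_cube adj m' S'"
      using mixed_cube[OF cube] 4(1) by metis
    have "False # True # r \<in> blocks n k" if "r \<in> S'" for r
      using that sub S'(2) by (auto simp: twin_def)
    then have "5 \<le> n \<and> 3 \<le> k \<and> r \<in> blocks (n - 5) (k - 3)" if "r \<in> S'" for r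
      using that by (simp add: blocks_two_iff)
    moreover have "S' \<noteq> {}" using cube_nonempty S'(3) by blast
    ultimately have "5 \<le> n \<and> 3 \<le> k" "S' \<subseteq> blocks (n - 5) (k - 3)" by blast+
    then show ?thesis using S' by (auto simp: cubes_def)
  qed
next
  fix S assume "S \<in> (?A \<union> ?B) \<union> (?C \<union> ?D)"
  then consider "S \<in> ?A" | "S \<in> ?B" | "S \<in> ?C" | "S \<in> ?D" by blast
  then show "S \<in> cubes n k m"
  proof cases
    case 1
    have "is_cube adj 0 {[]}"
      unfolding is_cube_def cube_embedding_def
      by (intro exI[of _ "\<lambda>_. []"]) (auto simp: adj_def)
    then show ?thesis using 1 by (auto simp: cubes_def blocks_iff split: if_splits)
  next
    case 2
    then show ?thesis
      by (auto simp: cubes_def blocks_iff is_cube_image_Cons split: if_splits)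
  next
    case 3
    then show ?thesis
      by (auto simp: cubes_def blocks_iff is_cube_image_Cons split: if_splits)
  next
    case 4
    then obtain S' where S': "S = twin S'" "S' \<in> cubes (n - 5) (k - 3) (m - 1)"
      and nkm: "5 \<le> n" "3 \<le> k" "1 \<le> m" by (auto split: if_splits)
    have "is_cube adj m S" using S' nkm is_cube_twin[of "m - 1" S'] by (simp add: cubes_def)
    moreover have "S \<subseteq> blocks n k"
      using S' nkm by (auto simp: cubes_def twin_def blocks_two_iff)
    ultimately show ?thesis by (simp add: cubes_def)
  qed
qed

lemma inj_twin: "inj twin"
proof (rule injI)
  fix S T assume "twin S = twin T"
  moreover have "S = {s. False # True # s \<in> twin S}" for S by (auto simp: twin_def)
  ultimately show "S = T" by metis
qed

text \<open>The four families are disjoint because the first blocks occurring in a cube tell them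
  apart, and the maps producing them are injective.\<close>

lemma card_cubes:
  "card (cubes n k m) =
    (if n = 1 \<and> k = 0 \<and> m = 0 then 1 else 0) +
    (if 2 \<le> n \<and> 1 \<le> k then card (cubes (n - 2) (k - 1) m) else 0) +
    (if 3 \<le> n \<and> 2 \<le> k then card (cubes (n - 3) (k - 2) m) else 0) +
    (if 5 \<le> n \<and> 3 \<le> k \<and> 1 \<le> m then card (cubes (n - 5) (k - 3) (m - 1)) else 0)"
proof -
  let ?A = "if n = 1 \<and> k = 0 \<and> m = 0 then {{[]}} else {} :: bool list set set"
  let ?B = "if 2 \<le> n \<and> 1 \<le> k then (`) (Cons False) ` cubes (n - 2) (k - 1) m else {}"
  let ?C = "if 3 \<le> n \<and> 2 \<le> k then (`) (Cons True) ` cubes (n - 3) (k - 2) m else {}"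
  let ?D = "if 5 \<le> n \<and> 3 \<le> k \<and> 1 \<le> m then twin ` cubes (n - 5) (k - 3) (m - 1) else {}"
  \<comment> \<open>Cubes are nonempty, which is essential for disjointness: an empty set would have
    no first block to identify its family.\<close>
  have ne: "\<exists>s. s \<in> S" if "S \<in> cubes n k m" for S n k m
    using that cube_nonempty by (fastforce simp: cubes_def)
  have B: "(\<exists>s. False # s \<in> S) \<and> S \<subseteq> range (Cons False)" if "S \<in> ?B" for S
    using that by (auto split: if_splits dest!: ne)
  have C: "(\<exists>s. True # s \<in> S) \<and> S \<subseteq> range (Cons True)" if "S \<in> ?C" for S
    using that by (auto split: if_splits dest!: ne)
  have D: "(\<exists>s. False # s \<in> S) \<and> (\<exists>s. True # s \<in> S)" if "S \<in> ?D" for S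
    using that by (auto simp: twin_def split: if_splits dest!: ne)
  have AB: "?A \<inter> ?B = {}" using B by (fastforce split: if_splits)
  have CD: "?C \<inter> ?D = {}" using C D by blast
  have ABCD: "(?A \<union> ?B) \<inter> (?C \<union> ?D) = {}"
  proof -
    have "S \<noteq> {[]}" if "S \<in> ?C \<union> ?D" for S using that C D by blast
    then have "?A \<inter> (?C \<union> ?D) = {}" by (simp split: if_split)
    moreover have "?B \<inter> (?C \<union> ?D) = {}" using B C D by blast
    ultimately show ?thesis by blast
  qed
  have fin: "finite ?A" "finite ?B" "finite ?C" "finite ?D" using finite_cubes by auto
  have "inj ((`) (Cons a))" for a :: bool by (intro inj_onI) (auto simp: inj_image_eq_iff)
  then have img: "card ((`) (Cons a) ` X) = card X" "card (twin ` X) = card X" for a X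
    using inj_twin by (metis card_image inj_on_subset subset_UNIV)+
  have "card (cubes n k m) = (card ?A + card ?B) + (card ?C + card ?D)"
    unfolding cubes_decomp[of n k m] using fin AB CD ABCD
    by (simp only: card_Un_disjoint finite_Un)
  then show ?thesis by (simp only: if_distrib[of card] img card.empty ) simp
qed

section \<open>The recursion for cube polynomials and its generating function\<close>

lemma cube_poly_padovan_graph:
  "cube_poly (with_proj (padovan_graph n k)) =
    (if n = 1 \<and> k = 0 then 1 else 0) +
    (if 2 \<le> n \<and> 1 \<le> k then cube_poly (with_proj (padovan_graph (n - 2) (k - 1))) else 0) +
    (if 3 \<le> n \<and> 2 \<le> k then cube_poly (with_proj (padovan_graph (n - 3) (k - 2))) else 0) +
    (if 5 \<le> n \<and> 3 \<le> k then [:0, 1:] * cube_poly (with_proj (padovan_graph (n - 5) (k - 3))) else 0)"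
proof (rule poly_eqI)
  fix m
  have coeff: "coeff (cube_poly (with_proj (padovan_graph n k))) m = int (card (cubes n k m))" for n k m
  proof -
    interpret pair_graph "padovan_graph n k" by (rule pair_graph_padovan_graph)
    show ?thesis
      using pair_finite_verts by (simp add: coeff_cube_poly cube_count_padovan_graph)
  qed
  show "coeff (cube_poly (with_proj (padovan_graph n k))) m = coeff (
    (if n = 1 \<and> k = 0 then 1 else 0) +
    (if 2 \<le> n \<and> 1 \<le> k then cube_poly (with_proj (padovan_graph (n - 2) (k - 1))) else 0) +
    (if 3 \<le> n \<and> 2 \<le> k then cube_poly (with_proj (padovan_graph (n - 3) (k - 2))) else 0) +
    (if 5 \<le> n \<and> 3 \<le> k then [:0, 1:] * cube_poly (with_proj (padovan_graph (n - 5) (k - 3))) else 0)) m"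
    unfolding coeff card_cubes[of n k m]
    \<comment> \<open>Multiplication by \<open>[:0, 1:]\<close> shifts the dimension by one, as a
      prism does; the case \<open>m = 0\<close> matches the guard \<open>1 \<le> m\<close>.\<close>
    by (cases m) (auto simp: coeff coeff_pCons)
qed

theorem theorem5p1:
  fixes x y z :: "int poly fps fps"
  defines "x \<equiv> fps_const (fps_const [:0, 1:])"
    and "y \<equiv> fps_X"
    and "z \<equiv> fps_const fps_X"
  shows "Abs_fps (\<lambda>n. Abs_fps (\<lambda>k. cube_poly (with_proj (padovan_graph n k)))) =
    fps_quot y (1 - y^2 * z * (1 + y * z * (1 + x * y^2 * z)))"
proof -
  define F where "F = Abs_fps (\<lambda>n. Abs_fps (\<lambda>k. cube_poly (with_proj (padovan_graph n k))))"
  \<comment> \<open>Multiplying by a monomial shifts both indices, with exactly the guards of the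
    recursion.\<close>
  have nth: "fps_nth (fps_nth (F * fps_const (fps_const c * fps_X ^ j) * fps_X ^ i) n) k =
      (if i \<le> n \<and> j \<le> k then c * cube_poly (with_proj (padovan_graph (n - i) (k - j))) else 0)"
    for c i j n k
    by (auto simp: F_def fps_X_power_mult_right_nth
        mult.assoc[symmetric] mult.commute[of c])
  have "F = y + F * fps_const (fps_const 1 * fps_X ^ 1) * fps_X ^ 2
      + F * fps_const (fps_const 1 * fps_X ^ 2) * fps_X ^ 3
      + F * fps_const (fps_const [:0, 1:] * fps_X ^ 3) * fps_X ^ 5"
  proof (intro fps_ext)
    fix n k
    have "fps_nth (fps_nth F n) k = cube_poly (with_proj (padovan_graph n k))"
      by (simp add: F_def)
    then show "fps_nth (fps_nth F n) k = fps_nth (fps_nth (y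
      + F * fps_const (fps_const 1 * fps_X ^ 1) * fps_X ^ 2
      + F * fps_const (fps_const 1 * fps_X ^ 2) * fps_X ^ 3
      + F * fps_const (fps_const [:0, 1:] * fps_X ^ 3) * fps_X ^ 5) n) k"
      \<comment> \<open>The recursion is substituted once, in the left-hand coefficient only; as a
        rewrite rule it would apply to its own right-hand side.\<close>
      unfolding fps_add_nth nth by (subst (asm) cube_poly_padovan_graph) (simp add: y_def fps_X_def)
  qed
  also have "\<dots> = y + F * z * y ^ 2 + F * z ^ 2 * y ^ 3 + F * (x * z ^ 3) * y ^ 5"
    by (simp add: x_def y_def z_def fps_const_power fps_const_mult)
  \<comment> \<open>The nested denominator expands to
    \<open>1 - y^2 * z - y^3 * z^2 - x * y^5 * z^3\<close>.\<close>
  finally have "F * (1 - y^2 * z * (1 + y * z * (1 + x * y^2 * z))) = y"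
    by (simp add: algebra_simps power2_eq_square power3_eq_cube eval_nat_numeral)
  moreover have "fps_nth (1 - y^2 * z * (1 + y * z * (1 + x * y^2 * z))) 0 = 1"
    by (simp add: y_def)
  ultimately show ?thesis
    unfolding F_def[symmetric] by (simp only: fps_quot_unique)
qed

end
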